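(* Let $\boldsymbol{p}=\prod_{k=1}^K[\underline p_k,\overline p_k]\subset\mathbb{R}^K$ be a box with $\underline p_k\le\overline p_k$, midpoint $p^c$ and radius $p^\Delta$, let $A^{(0)},\dots,A^{(K)}\in\mathbb{R}^{n\times n}$, let $A(p)=A^{(0)}+\sum_{k=1}^K A^{(k)}p_k$, and suppose that the parametric interval matrix $A(\boldsymbol{p})$ is symmetric, i.e. $A(p)$ is a symmetric matrix for every $p\in\boldsymbol{p}$. Suppose that $A(p^c)$ is stable and that $$\rho\left(\left|A(p^c)^{-1}\right|B\right)<1,\qquad\text{where } B=\sum_{k=1}^K|A^{(k)}|\,p^\Delta_k .$$ Then $A(\boldsymbol{p})$ is stable.
   Context: A parametric interval matrix with affine-linear dependencies is a family $A(\boldsymbol{p})=\{A(p)=A^{(0)}+\sum_{k=1}^K A^{(k)}p_k \mid p\in\boldsymbol{p}\}$ of real $n\times n$ matrices, where $\boldsymbol{p}$ is a product of compact intervals. The midpoint and radius are $p^c_k=(\underline p_k+\overline p_k)/2$ and $p^\Delta_k=(\overline p_k-\underline p_k)/2$. For a real matrix $M$, $|M|$ is the matrix of entrywise absolute values, and $\rho(M)$ is the spectral radius. A real square matrix is stable (Hurwitz) if every eigenvalue has strictly negative real part (in particular a stable matrix is nonsingular). $A(\boldsymbol{p})$ is stable if $A(p)$ is stable for each $p\in\boldsymbol{p}$. *)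

theory Defs
  imports
    "HOL-Library.FuncSet"
    "Jordan_Normal_Form.Gauss_Jordan_Elimination"
    "Jordan_Normal_Form.Spectral_Radius"
begin

text \<open>
  A parameter vector \<open>p \<in> \<real>\<^sup>K\<close> is a function on the index set \<open>{1..K}\<close>, extended by
  \<open>undefined\<close> outside of it. The coefficient matrices \<open>A\<^sup>(\<^sup>0\<^sup>)\<close>, ..., \<open>A\<^sup>(\<^sup>K\<^sup>)\<close> form a sequence
  \<open>A :: nat \<Rightarrow> real mat\<close>, of which only the members \<open>A 0\<close>, ..., \<open>A K\<close> are used.
\<close>

definition param_box :: "nat \<Rightarrow> (nat \<Rightarrow> real) \<Rightarrow> (nat \<Rightarrow> real) \<Rightarrow> (nat \<Rightarrow> real) set" where
  "param_box K lo up = (\<Pi>\<^sub>E k\<in>{1..K}. {lo k..up k})"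

definition box_mid :: "nat \<Rightarrow> (nat \<Rightarrow> real) \<Rightarrow> (nat \<Rightarrow> real) \<Rightarrow> nat \<Rightarrow> real" where
  "box_mid K lo up = (\<lambda>k\<in>{1..K}. (lo k + up k) / 2)"

definition box_rad :: "nat \<Rightarrow> (nat \<Rightarrow> real) \<Rightarrow> (nat \<Rightarrow> real) \<Rightarrow> nat \<Rightarrow> real" where
  "box_rad K lo up = (\<lambda>k\<in>{1..K}. (up k - lo k) / 2)"

text \<open>
  Sums of matrices are written entrywise, since the type of matrices of all dimensions has no
  common zero matrix and hence no \<open>\<Sum>\<close>.
\<close>

definition param_mat :: "nat \<Rightarrow> nat \<Rightarrow> (nat \<Rightarrow> real mat) \<Rightarrow> (nat \<Rightarrow> real) \<Rightarrow> real mat" where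
  "param_mat n K A p =
     mat n n (\<lambda>(i, j). A 0 $$ (i, j) + (\<Sum>k = 1..K. A k $$ (i, j) * p k))"

definition abs_mat :: "real mat \<Rightarrow> real mat" where
  "abs_mat M = map_mat abs M"

definition rad_mat ::
  "nat \<Rightarrow> nat \<Rightarrow> (nat \<Rightarrow> real mat) \<Rightarrow> (nat \<Rightarrow> real) \<Rightarrow> (nat \<Rightarrow> real) \<Rightarrow> real mat" where
  "rad_mat n K A lo up =
     mat n n (\<lambda>(i, j). \<Sum>k = 1..K. abs_mat (A k) $$ (i, j) * box_rad K lo up k)"

definition real_spectral_radius :: "real mat \<Rightarrow> real" where
  "real_spectral_radius M = spectral_radius (map_mat complex_of_real M)"

definition stable_mat :: "real mat \<Rightarrow> bool" where
  "stable_mat M \<longleftrightarrow>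
     square_mat M \<and> (\<forall>z. eigenvalue (map_mat complex_of_real M) z \<longrightarrow> Re z < 0)"

definition symmetric_param ::
  "nat \<Rightarrow> nat \<Rightarrow> (nat \<Rightarrow> real mat) \<Rightarrow> (nat \<Rightarrow> real) \<Rightarrow> (nat \<Rightarrow> real) \<Rightarrow> bool" where
  "symmetric_param n K A lo up \<longleftrightarrow>
     (\<forall>p\<in>param_box K lo up. transpose_mat (param_mat n K A p) = param_mat n K A p)"

definition stable_param ::
  "nat \<Rightarrow> nat \<Rightarrow> (nat \<Rightarrow> real mat) \<Rightarrow> (nat \<Rightarrow> real) \<Rightarrow> (nat \<Rightarrow> real) \<Rightarrow> bool" where
  "stable_param n K A lo up \<longleftrightarrow> (\<forall>p\<in>param_box K lo up. stable_mat (param_mat n K A p))"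

text \<open>
  \<open>mat_inverse\<close> is option-valued; \<open>the (mat_inverse M)\<close> is the inverse of \<open>M\<close> whenever \<open>M\<close>
  is nonsingular, in particular whenever \<open>M\<close> is stable.
\<close>

definition mat_inv :: "real mat \<Rightarrow> real mat" where
  "mat_inv M = the (mat_inverse M)"

end

theory Submission
  imports Defs "HOL-Analysis.Function_Topology"
begin

text \<open>
  For a real symmetric matrix, stability means that all eigenvalues are negative, that is, that
  the form \<open>x \<bullet> Q x\<close> is negative definite. Negative definiteness cannot be lost along a straight
  segment of symmetric matrices without passing a singular matrix: at the first parameter where
  it fails, the form is still negative semidefinite by continuity and vanishes at some nonzero
  \<open>x\<close>, which then lies in the kernel (\<open>neg_definite_along_segment\<close>).

  The spectral condition excludes such a singular matrix between \<open>M = A(p\<^sup>c)\<close> and \<open>S = A(p)\<close>.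
  Write \<open>B\<close> for the radius matrix, so that \<open>\<bar>S - M\<bar> \<le> B\<close> entrywise. If
  \<open>(M + t (S - M)) x = 0\<close> with \<open>0 \<le> t \<le> 1\<close>, then \<open>x = - t M\<^sup>-\<^sup>1 (S - M) x\<close>, hence
  \<open>\<bar>x\<bar> \<le> G \<bar>x\<bar>\<close> for the nonnegative matrix \<open>G = \<bar>M\<^sup>-\<^sup>1\<bar> B\<close>. Iterating gives \<open>\<bar>x\<bar> \<le> G\<^sup>k \<bar>x\<bar>\<close>, and
  the right-hand side tends to \<open>0\<close> because \<open>\<rho>(G) < 1\<close>, so \<open>x = 0\<close>
  (\<open>nonneg_subinvariant_vec_zero\<close>, \<open>segment_nonsingular\<close>).

  The same segment argument links stability and definiteness without diagonalization. On the
  segment from \<open>- I\<close> to a symmetric stable \<open>M\<close>, a singular matrix would turn into a real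
  eigenvalue \<open>(1 - t) / t \<ge> 0\<close> of \<open>M\<close>; so \<open>M\<close> is negative definite
  (\<open>stable_symmetric_imp_neg_definite\<close>). Conversely, if \<open>a + \<i> b\<close> is an eigenvector of a
  negative definite matrix, the values of the form at \<open>a\<close> and \<open>b\<close> add up to a positive multiple
  of the real part of the eigenvalue (\<open>neg_definite_imp_stable\<close>).
\<close>

section \<open>Quadratic forms\<close>

definition neg_definite :: "nat \<Rightarrow> real mat \<Rightarrow> bool" where
  "neg_definite n Q \<longleftrightarrow> (\<forall>x\<in>carrier_vec n. x \<noteq> 0\<^sub>v n \<longrightarrow> x \<bullet> (Q *\<^sub>v x) < 0)"

lemma scalar_prod_self_nonpos_imp_zero:
  fixes x :: "real vec"
  assumes "x \<in> carrier_vec n" "x \<bullet> x \<le> 0"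
  shows "x = 0\<^sub>v n"
proof -
  have "(\<Sum>i<n. x $ i * x $ i) \<le> 0"
    using assms by (simp add: scalar_prod_def lessThan_atLeast0)
  then have "(\<Sum>i<n. x $ i * x $ i) = 0"
    by (meson order_antisym sum_nonneg zero_le_square)
  then have "x $ i = 0" if "i < n" for i
    using that by (subst (asm) sum_nonneg_eq_0_iff) auto
  then show ?thesis using assms by auto
qed

lemma smult_mat_mult_vec:
  fixes M :: "'a :: comm_ring_1 mat"
  assumes "M \<in> carrier_mat m n" "x \<in> carrier_vec n"
  shows "(c \<cdot>\<^sub>m M) *\<^sub>v x = c \<cdot>\<^sub>v (M *\<^sub>v x)"
  using assms by (intro eq_vecI) (auto simp: row_smult)

lemma symmetric_form_commute:
  fixes Q :: "real mat"
  assumes "Q \<in> carrier_mat n n" "transpose_mat Q = Q" "x \<in> carrier_vec n" "y \<in> carrier_vec n"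
  shows "x \<bullet> (Q *\<^sub>v y) = y \<bullet> (Q *\<^sub>v x)"
  by (metis assms comm_scalar_prod mult_mat_vec_carrier transpose_vec_mult_scalar)

text \<open>
  A zero of the form is a maximum, so the derivative \<open>2 Q x\<close> of the form must vanish there. The
  proof moves from \<open>x\<close> in the direction \<open>w = Q x\<close>: the form at \<open>x + s w\<close> is
  \<open>2 s (w \<bullet> w) + s\<^sup>2 (w \<bullet> Q w)\<close>, which would be positive for small \<open>s > 0\<close> if \<open>w \<noteq> 0\<close>.
\<close>

lemma neg_semidefinite_kernel:
  fixes Q :: "real mat"
  assumes Q: "Q \<in> carrier_mat n n" and sym: "transpose_mat Q = Q"
    and semi: "\<And>y. y \<in> carrier_vec n \<Longrightarrow> y \<bullet> (Q *\<^sub>v y) \<le> 0"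
    and x: "x \<in> carrier_vec n" and x0: "0 \<le> x \<bullet> (Q *\<^sub>v x)"
  shows "Q *\<^sub>v x = 0\<^sub>v n"
proof -
  define w where "w = Q *\<^sub>v x"
  have w: "w \<in> carrier_vec n" using Q x by (simp add: w_def)
  define a where "a = w \<bullet> w"
  define b where "b = w \<bullet> (Q *\<^sub>v w)"
  have xx: "x \<bullet> (Q *\<^sub>v x) = 0" using semi[OF x] x0 by simp
  have xw: "x \<bullet> (Q *\<^sub>v w) = a"
    using symmetric_form_commute[OF Q sym x w] by (simp add: a_def w_def)
  have wx: "w \<bullet> (Q *\<^sub>v x) = a" by (simp add: a_def w_def)
  have expand: "(x + s \<cdot>\<^sub>v w) \<bullet> (Q *\<^sub>v (x + s \<cdot>\<^sub>v w)) = 2 * s * a + s\<^sup>2 * b" for s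
  proof -
    have "Q *\<^sub>v (x + s \<cdot>\<^sub>v w) = Q *\<^sub>v x + s \<cdot>\<^sub>v (Q *\<^sub>v w)"
      using Q x w by (simp add: mult_add_distrib_mat_vec mult_mat_vec)
    moreover have "Q *\<^sub>v x \<in> carrier_vec n" "Q *\<^sub>v w \<in> carrier_vec n" using Q x w by auto
    ultimately show ?thesis using x w
      by (simp add: add_scalar_prod_distrib[of _ n] scalar_prod_add_distrib[of _ n]
          xx xw wx b_def[symmetric] power2_eq_square algebra_simps)
  qed
  have "a \<le> 0"
  proof (rule ccontr)
    assume "\<not> a \<le> 0"
    then have a: "a > 0" by simp
    define s where "s = a / (1 + \<bar>b\<bar>)"
    have s: "s > 0" using a by (simp add: s_def add_pos_nonneg)
    have "s * \<bar>b\<bar> \<le> a" using a by (simp add: s_def field_simps)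
    then have "- a \<le> s * b" using s by (smt (verit) minus_mult_right mult_left_mono)
    then have "s * (2 * a + s * b) > 0" using s a by (intro mult_pos_pos) auto
    then show False
      using semi[of "x + s \<cdot>\<^sub>v w"] x w unfolding expand
      by (simp add: power2_eq_square algebra_simps)
  qed
  then show ?thesis
    using scalar_prod_self_nonpos_imp_zero[OF w] by (simp add: a_def w_def)
qed

text \<open>
  Vectors are represented by functions vanishing from \<open>n\<close> on, because function spaces carry the
  product topology; the sphere is a closed subset of a product of compact intervals.
\<close>

lemma compact_unit_sphere:
  "compact {f :: nat \<Rightarrow> real. (\<forall>i\<ge>n. f i = 0) \<and> (\<Sum>i<n. (f i)\<^sup>2) = 1}" (is "compact ?S")
proof -
  let ?B = "PiE UNIV (\<lambda>i. if i < n then {-1..1} else {0}) :: (nat \<Rightarrow> real) set"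
  have "compactin (product_topology (\<lambda>i. euclidean) UNIV) ?B"
    by (subst compactin_PiE) auto
  then have "compact ?B" by (simp add: euclidean_product_topology)
  moreover have "closed {f :: nat \<Rightarrow> real. (\<Sum>i<n. (f i)\<^sup>2) = 1}"
    by (intro closed_Collect_eq continuous_intros) auto
  moreover have "?S = ?B \<inter> {f. (\<Sum>i<n. (f i)\<^sup>2) = 1}"
  proof -
    have "f i \<in> {-1..1}" if "(\<Sum>i<n. (f i)\<^sup>2) = 1" "i < n" for f :: "nat \<Rightarrow> real" and i
    proof -
      have "(f i)\<^sup>2 \<le> (\<Sum>i<n. (f i)\<^sup>2)" using that(2) by (intro member_le_sum) auto
      then have "\<bar>f i\<bar> \<le> 1" using that(1) by (simp add: abs_square_le_1)
      then show ?thesis by auto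
    qed
    then show ?thesis by (auto simp: PiE_UNIV_domain split: if_splits)
  qed
  ultimately show ?thesis by (simp add: compact_Int_closed)
qed


section \<open>Negative definiteness along a segment\<close>

definition segment :: "real mat \<Rightarrow> real mat \<Rightarrow> real \<Rightarrow> real mat" where
  "segment P S t = (1 - t) \<cdot>\<^sub>m P + t \<cdot>\<^sub>m S"

lemma segment_carrier [simp]:
  "P \<in> carrier_mat n n \<Longrightarrow> S \<in> carrier_mat n n \<Longrightarrow> segment P S t \<in> carrier_mat n n"
  by (simp add: segment_def)

lemma segment_mult_vec:
  assumes "P \<in> carrier_mat n n" "S \<in> carrier_mat n n" "x \<in> carrier_vec n"
  shows "segment P S t *\<^sub>v x = (1 - t) \<cdot>\<^sub>v (P *\<^sub>v x) + t \<cdot>\<^sub>v (S *\<^sub>v x)"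
  using assms unfolding segment_def
  by (simp add: add_mult_distrib_mat_vec[of _ n n] smult_mat_mult_vec)

lemma segment_form:
  assumes "P \<in> carrier_mat n n" "S \<in> carrier_mat n n" "x \<in> carrier_vec n"
  shows "x \<bullet> (segment P S t *\<^sub>v x) = (1 - t) * (x \<bullet> (P *\<^sub>v x)) + t * (x \<bullet> (S *\<^sub>v x))"
proof -
  have "P *\<^sub>v x \<in> carrier_vec n" "S *\<^sub>v x \<in> carrier_vec n" using assms by auto
  then show ?thesis using assms by (simp add: segment_mult_vec scalar_prod_add_distrib[of _ n])
qed

lemma segment_symmetric:
  assumes "P \<in> carrier_mat n n" "S \<in> carrier_mat n n"
    "transpose_mat P = P" "transpose_mat S = S"
  shows "transpose_mat (segment P S t) = segment P S t"
proof (rule eq_matI)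
  fix i j assume "i < dim_row (segment P S t)" "j < dim_col (segment P S t)"
  then have ij: "i < n" "j < n" using assms by (auto simp: segment_def)
  have "P $$ (j, i) = P $$ (i, j)" "S $$ (j, i) = S $$ (i, j)"
    using assms ij by (metis carrier_matD index_transpose_mat(1))+
  then show "transpose_mat (segment P S t) $$ (i, j) = segment P S t $$ (i, j)"
    using assms ij by (simp add: segment_def)
qed (use assms in \<open>auto simp: segment_def\<close>)

lemma neg_definite_iff_unit_sphere:
  assumes Q: "Q \<in> carrier_mat n n"
  shows "neg_definite n Q \<longleftrightarrow>
    (\<forall>f. (\<forall>i\<ge>n. f i = 0) \<and> (\<Sum>i<n. (f i)\<^sup>2) = 1 \<longrightarrow> vec n f \<bullet> (Q *\<^sub>v vec n f) < 0)"
    (is "_ \<longleftrightarrow> ?R")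
proof
  assume L: "neg_definite n Q"
  have "vec n f \<noteq> 0\<^sub>v n" if "(\<Sum>i<n. (f i)\<^sup>2) = 1" for f :: "nat \<Rightarrow> real"
  proof
    assume "vec n f = 0\<^sub>v n"
    then have "f i = 0" if "i < n" for i using that by (metis index_vec index_zero_vec(1))
    then show False using that by simp
  qed
  then show ?R using L by (auto simp: neg_definite_def)
next
  assume R: ?R
  show "neg_definite n Q" unfolding neg_definite_def
  proof (intro ballI impI)
    fix x :: "real vec" assume x: "x \<in> carrier_vec n" "x \<noteq> 0\<^sub>v n"
    define c where "c = sqrt (x \<bullet> x)"
    have xx: "x \<bullet> x > 0" using scalar_prod_self_nonpos_imp_zero[OF x(1)] x(2) by force
    then have c: "c > 0" by (simp add: c_def)
    define f where "f i = (if i < n then x $ i / c else 0)" for i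
    have "(\<Sum>i<n. (f i)\<^sup>2) = (\<Sum>i<n. x $ i * x $ i) / c\<^sup>2"
      by (simp add: f_def sum_divide_distrib power2_eq_square)
    also have "(\<Sum>i<n. x $ i * x $ i) = x \<bullet> x"
      using x by (simp add: scalar_prod_def lessThan_atLeast0)
    finally have "(\<Sum>i<n. (f i)\<^sup>2) = 1" using xx by (simp add: c_def)
    then have neg: "vec n f \<bullet> (Q *\<^sub>v vec n f) < 0" using R by (simp add: f_def)
    have xf: "x = c \<cdot>\<^sub>v vec n f" using x(1) c by (auto simp: f_def)
    have "x \<bullet> (Q *\<^sub>v x) = c * (c * (vec n f \<bullet> (Q *\<^sub>v vec n f)))"
    proof -
      have "Q *\<^sub>v vec n f \<in> carrier_vec n" using Q by auto
      then show ?thesis unfolding xf using Q by (simp add: mult_mat_vec)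
    qed
    then show "x \<bullet> (Q *\<^sub>v x) < 0" using neg c by (simp add: mult_pos_neg)
  qed
qed

text \<open>
  The parameters at which definiteness fails are the projection of the compact set of pairs
  \<open>(t, f)\<close> with \<open>f\<close> on the unit sphere and a nonnegative value of the form, so if there are any
  there is a least one.
\<close>

lemma neg_definite_first_loss:
  assumes P: "P \<in> carrier_mat n n" and S: "S \<in> carrier_mat n n" and "\<not> neg_definite n S"
  obtains t where "t \<in> {0..1}" "\<not> neg_definite n (segment P S t)"
    "\<And>s. 0 \<le> s \<Longrightarrow> s < t \<Longrightarrow> neg_definite n (segment P S s)"
proof -
  let ?U = "{f :: nat \<Rightarrow> real. (\<forall>i\<ge>n. f i = 0) \<and> (\<Sum>i<n. (f i)\<^sup>2) = 1}"
  define q where "q z = vec n (snd z) \<bullet> (segment P S (fst z) *\<^sub>v vec n (snd z))"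
    for z :: "real \<times> (nat \<Rightarrow> real)"
  define T where "T = {t \<in> {0..1}. \<not> neg_definite n (segment P S t)}"
  have q_sum: "q z = (\<Sum>i<n. snd z i * (\<Sum>j<n. ((1 - fst z) * P $$ (i, j) + fst z * S $$ (i, j)) * snd z j))"
    for z
    using P S unfolding q_def segment_def
    by (simp add: scalar_prod_def lessThan_atLeast0)
  have coord: "continuous_on UNIV (\<lambda>z :: real \<times> (nat \<Rightarrow> real). snd z i)" for i
    by (rule continuous_on_product_then_coordinatewise) (intro continuous_intros)
  have "continuous_on UNIV q"
    unfolding q_sum[abs_def] by (intro continuous_intros coord)
  then have "closed {z. 0 \<le> q z}" by (intro closed_Collect_le continuous_intros) auto
  then have "compact (({0..1} \<times> ?U) \<inter> {z. 0 \<le> q z})"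
    by (intro compact_Int_closed compact_Times compact_unit_sphere) auto
  then have "compact (fst ` (({0..1} \<times> ?U) \<inter> {z. 0 \<le> q z}))"
    by (intro compact_continuous_image continuous_intros)
  also have "fst ` (({0..1} \<times> ?U) \<inter> {z. 0 \<le> q z}) = T"
  proof (intro equalityI subsetI)
    fix t assume "t \<in> T"
    then obtain f where "t \<in> {0..1}" "f \<in> ?U" "0 \<le> q (t, f)"
      using P S by (auto simp: T_def q_def neg_definite_iff_unit_sphere not_less)
    then show "t \<in> fst ` (({0..1} \<times> ?U) \<inter> {z. 0 \<le> q z})"
      by (intro image_eqI[of _ _ "(t, f)"]) auto
  qed (use P S in \<open>auto simp: T_def q_def neg_definite_iff_unit_sphere not_less\<close>)
  finally have "compact T" .
  moreover have "1 \<in> T"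
  proof -
    have "segment P S 1 = S" using P S by (intro eq_matI) (auto simp: segment_def)
    then show ?thesis using assms by (simp add: T_def)
  qed
  ultimately obtain t where t: "t \<in> T" and min: "\<And>s. s \<in> T \<Longrightarrow> t \<le> s"
    using compact_attains_inf[of T] by blast
  show thesis
  proof (rule that)
    show "t \<in> {0..1}" "\<not> neg_definite n (segment P S t)" using t by (auto simp: T_def)
    show "neg_definite n (segment P S s)" if "0 \<le> s" "s < t" for s
      using that t min[of s] by (auto simp: T_def)
  qed
qed

text \<open>
  At the first loss \<open>t\<close> the matrix is negative semidefinite, being a limit of negative definite
  ones, and its form is nonnegative at some \<open>x \<noteq> 0\<close>; such an \<open>x\<close> lies in the kernel.
\<close>

lemma neg_definite_along_segment:
  assumes P: "P \<in> carrier_mat n n" and S: "S \<in> carrier_mat n n"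
    and symP: "transpose_mat P = P" and symS: "transpose_mat S = S"
    and negP: "neg_definite n P"
    and nonsing: "\<And>t x. 0 < t \<Longrightarrow> t \<le> 1 \<Longrightarrow> x \<in> carrier_vec n \<Longrightarrow>
      segment P S t *\<^sub>v x = 0\<^sub>v n \<Longrightarrow> x = 0\<^sub>v n"
  shows "neg_definite n S"
proof (rule ccontr)
  assume "\<not> neg_definite n S"
  then obtain t where t: "t \<in> {0..1}" and loss: "\<not> neg_definite n (segment P S t)"
    and before: "\<And>s. 0 \<le> s \<Longrightarrow> s < t \<Longrightarrow> neg_definite n (segment P S s)"
    using neg_definite_first_loss[OF P S] by metis
  obtain x where x: "x \<in> carrier_vec n" "x \<noteq> 0\<^sub>v n" "0 \<le> x \<bullet> (segment P S t *\<^sub>v x)"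
    using loss by (auto simp: neg_definite_def not_less)
  have "segment P S 0 = P" using P S by (intro eq_matI) (auto simp: segment_def)
  then have t0: "0 < t" using loss negP t by (cases "t = 0") auto
  have semi: "y \<bullet> (segment P S t *\<^sub>v y) \<le> 0" if y: "y \<in> carrier_vec n" for y
  proof (rule ccontr)
    assume "\<not> y \<bullet> (segment P S t *\<^sub>v y) \<le> 0"
    define p where "p = y \<bullet> (P *\<^sub>v y)"
    define r where "r = y \<bullet> (S *\<^sub>v y)"
    have pos: "0 < p + t * (r - p)"
      using \<open>\<not> y \<bullet> (segment P S t *\<^sub>v y) \<le> 0\<close> segment_form[OF P S y, of t]
      by (simp add: p_def r_def algebra_simps)
    have "y \<noteq> 0\<^sub>v n"
    proof
      assume "y = 0\<^sub>v n"
      then have "p = 0" "r = 0" using P S by (auto simp: p_def r_def)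
      then show False using pos by simp
    qed
    then have p: "p < 0" using negP y by (simp add: neg_definite_def p_def)
    then have "0 < t * (r - p)" using pos by linarith
    then have rp: "0 < r - p" using t0 by (simp add: zero_less_mult_iff)
    \<comment> \<open>The form at \<open>y\<close> is affine in the parameter, negative at \<open>0\<close> and positive at \<open>t\<close>; \<open>s\<close> is its
      zero, and it contradicts definiteness before \<open>t\<close>.\<close>
    define s where "s = - p / (r - p)"
    have "0 \<le> s" unfolding s_def using p rp by (intro divide_nonneg_pos) auto
    moreover have "s < t" using pos rp by (simp add: s_def field_simps)
    ultimately have "y \<bullet> (segment P S s *\<^sub>v y) < 0"
      using before \<open>y \<noteq> 0\<^sub>v n\<close> y by (simp add: neg_definite_def)
    moreover have "y \<bullet> (segment P S s *\<^sub>v y) = p + s * (r - p)"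
      using segment_form[OF P S y, of s] by (simp add: p_def r_def algebra_simps)
    moreover have "s * (r - p) = - p" using rp by (simp add: s_def)
    ultimately show False by simp
  qed
  have "segment P S t *\<^sub>v x = 0\<^sub>v n"
    by (rule neg_semidefinite_kernel[OF segment_carrier[OF P S]
          segment_symmetric[OF P S symP symS] semi x(1) x(3)])
  then show False using nonsing[OF t0 _ x(1)] x(2) t by simp
qed

section \<open>Stability of symmetric matrices\<close>

lemma neg_definite_minus_one: "neg_definite n (- 1\<^sub>m n)"
proof -
  have "x \<bullet> ((- 1\<^sub>m n) *\<^sub>v x) < 0" if "x \<in> carrier_vec n" "x \<noteq> 0\<^sub>v n" for x :: "real vec"
  proof -
    have "(- 1\<^sub>m n) *\<^sub>v x = - x" using that by (simp add: uminus_mult_mat_vec)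
    then show ?thesis using scalar_prod_self_nonpos_imp_zero[OF that(1)] that by force
  qed
  then show ?thesis by (simp add: neg_definite_def)
qed

text \<open>
  A kernel vector of \<open>(1 - t) (- I) + t S\<close> is an eigenvector of \<open>S\<close> for the eigenvalue
  \<open>(1 - t) / t \<ge> 0\<close>, which stability forbids. Hence definiteness survives from \<open>- I\<close> to \<open>S\<close>.
\<close>

lemma stable_symmetric_imp_neg_definite:
  assumes S: "S \<in> carrier_mat n n" and sym: "transpose_mat S = S" and st: "stable_mat S"
  shows "neg_definite n S"
proof (rule neg_definite_along_segment[OF _ S _ sym neg_definite_minus_one])
  show "- 1\<^sub>m n \<in> carrier_mat n n" by simp
  show "transpose_mat (- 1\<^sub>m n) = (- 1\<^sub>m n :: real mat)" by (simp add: transpose_uminus)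
  fix t :: real and x
  assume t: "0 < t" "t \<le> 1" and x: "x \<in> carrier_vec n"
    and z: "segment (- 1\<^sub>m n) S t *\<^sub>v x = 0\<^sub>v n"
  show "x = 0\<^sub>v n"
  proof (rule ccontr)
    assume nz: "x \<noteq> 0\<^sub>v n"
    let ?h = "complex_of_real" let ?c = "(1 - t) / t"
    have "(1 - t) \<cdot>\<^sub>v ((- 1\<^sub>m n) *\<^sub>v x) + t \<cdot>\<^sub>v (S *\<^sub>v x) = 0\<^sub>v n"
      using z segment_mult_vec[OF _ S x, of "- 1\<^sub>m n" t] by simp
    moreover have "(- 1\<^sub>m n) *\<^sub>v x = - x" using x by (simp add: uminus_mult_mat_vec)
    ultimately have eq: "(1 - t) \<cdot>\<^sub>v (- x) + t \<cdot>\<^sub>v (S *\<^sub>v x) = 0\<^sub>v n" by simp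
    have "S *\<^sub>v x = ?c \<cdot>\<^sub>v x"
    proof (intro eq_vecI)
      fix i assume "i < dim_vec (?c \<cdot>\<^sub>v x)"
      then have i: "i < n" using x by simp
      have "((1 - t) \<cdot>\<^sub>v (- x) + t \<cdot>\<^sub>v (S *\<^sub>v x)) $ i = 0" using i eq by simp
      then have "(1 - t) * (- x $ i) + t * (S *\<^sub>v x) $ i = 0"
        using i x S by (simp del: index_mult_mat_vec)
      then show "(S *\<^sub>v x) $ i = (?c \<cdot>\<^sub>v x) $ i"
        using t i x by (simp add: field_simps del: index_mult_mat_vec)
    qed (use S x in auto)
    then have "map_mat ?h S *\<^sub>v map_vec ?h x = ?h ?c \<cdot>\<^sub>v map_vec ?h x"
      using of_real_hom.mult_mat_vec_hom[OF S x] by (metis of_real_hom.vec_hom_smult)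
    moreover have "map_vec ?h x \<noteq> 0\<^sub>v n"
      using nz by (metis of_real_hom.vec_hom_zero_iff)
    ultimately have "eigenvalue (map_mat ?h S) (?h ?c)"
      using S x unfolding eigenvalue_def eigenvector_def by (intro exI[of _ "map_vec ?h x"]) auto
    then have "Re (?h ?c) < 0" using st unfolding stable_mat_def by blast
    then have "?c < 0" unfolding Re_complex_of_real .
    then show False using t by (simp add: divide_less_0_iff)
  qed
qed

text \<open>
  For an eigenvector \<open>a + \<i> b\<close> with eigenvalue \<open>z\<close>, the real and imaginary parts of the
  eigenvalue equation give \<open>S a = Re z a - Im z b\<close> and \<open>S b = Re z b + Im z a\<close>. In
  \<open>a \<bullet> S a + b \<bullet> S b\<close> the terms with \<open>Im z\<close> cancel, leaving \<open>Re z (a \<bullet> a + b \<bullet> b)\<close>.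
\<close>

lemma neg_definite_imp_stable:
  assumes S: "S \<in> carrier_mat n n" and neg: "neg_definite n S"
  shows "stable_mat S"
  unfolding stable_mat_def
proof (intro conjI allI impI)
  show "square_mat S" using S by simp
  fix z assume "eigenvalue (map_mat complex_of_real S) z"
  then obtain v where v: "v \<in> carrier_vec n" "v \<noteq> 0\<^sub>v n"
    and ev: "map_mat complex_of_real S *\<^sub>v v = z \<cdot>\<^sub>v v"
    using S by (auto simp: eigenvalue_def eigenvector_def)
  define a where "a = map_vec Re v"
  define b where "b = map_vec Im v"
  have ab: "a \<in> carrier_vec n" "b \<in> carrier_vec n" using v by (auto simp: a_def b_def)
  have comp: "(\<Sum>j<n. complex_of_real (S $$ (i, j)) * v $ j) = z * v $ i" if "i < n" for i
    using arg_cong[OF ev, of "\<lambda>w. w $ i"] that S v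
    by (simp add: scalar_prod_def lessThan_atLeast0)
  have Sa: "S *\<^sub>v a = Re z \<cdot>\<^sub>v a - Im z \<cdot>\<^sub>v b"
  proof (intro eq_vecI)
    fix i assume "i < dim_vec (Re z \<cdot>\<^sub>v a - Im z \<cdot>\<^sub>v b)"
    then have i: "i < n" using ab by simp
    show "(S *\<^sub>v a) $ i = (Re z \<cdot>\<^sub>v a - Im z \<cdot>\<^sub>v b) $ i"
      using arg_cong[OF comp[OF i], of Re] i S v
      by (simp add: a_def b_def scalar_prod_def lessThan_atLeast0)
  qed (use S ab in auto)
  have Sb: "S *\<^sub>v b = Re z \<cdot>\<^sub>v b + Im z \<cdot>\<^sub>v a"
  proof (intro eq_vecI)
    fix i assume "i < dim_vec (Re z \<cdot>\<^sub>v b + Im z \<cdot>\<^sub>v a)"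
    then have i: "i < n" using ab by simp
    show "(S *\<^sub>v b) $ i = (Re z \<cdot>\<^sub>v b + Im z \<cdot>\<^sub>v a) $ i"
      using arg_cong[OF comp[OF i], of Im] i S v
      by (simp add: a_def b_def scalar_prod_def lessThan_atLeast0)
  qed (use S ab in auto)
  have sum: "a \<bullet> (S *\<^sub>v a) + b \<bullet> (S *\<^sub>v b) = Re z * (a \<bullet> a + b \<bullet> b)"
    unfolding Sa Sb using ab comm_scalar_prod[OF ab]
    by (simp add: scalar_prod_add_distrib[of _ n] scalar_prod_minus_distrib[of _ n] algebra_simps)
  have form: "y \<bullet> (S *\<^sub>v y) \<le> 0" "0 \<le> y \<bullet> y" if "y \<in> carrier_vec n" for y
  proof -
    show "y \<bullet> (S *\<^sub>v y) \<le> 0"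
      using neg that S by (cases "y = 0\<^sub>v n") (auto simp: neg_definite_def less_imp_le)
    show "0 \<le> y \<bullet> y" by (auto simp: scalar_prod_def intro: sum_nonneg)
  qed
  have "a \<noteq> 0\<^sub>v n \<or> b \<noteq> 0\<^sub>v n"
  proof (rule ccontr)
    assume "\<not> (a \<noteq> 0\<^sub>v n \<or> b \<noteq> 0\<^sub>v n)"
    then have "Re (v $ i) = 0 \<and> Im (v $ i) = 0" if "i < n" for i
      using that v unfolding a_def b_def by (metis carrier_vecD index_map_vec(1) index_zero_vec(1))
    then have "v = 0\<^sub>v n" using v by (intro eq_vecI) (auto simp: complex_eq_iff)
    then show False using v by simp
  qed
  then have "a \<bullet> (S *\<^sub>v a) + b \<bullet> (S *\<^sub>v b) < 0"
    using neg ab form(1)[OF ab(1)] form(1)[OF ab(2)] unfolding neg_definite_def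
    by (metis add_less_le_mono add_le_less_mono add_0)
  then show "Re z < 0"
    unfolding sum using form(2)[OF ab(1)] form(2)[OF ab(2)]
    by (smt (verit) mult_nonneg_nonneg)
qed

section \<open>Nonnegative matrices of spectral radius below one\<close>

text \<open>
  The Jordan normal form gives bounded powers when the spectral radius is below \<open>1\<close>. To obtain
  decay, the matrix is first scaled by some \<open>a > 1\<close> that keeps its spectral radius below \<open>1\<close>: from
  \<open>v \<le> G v\<close> follows \<open>a\<^sup>k v \<le> (a G)\<^sup>k v\<close>, and a bounded right-hand side forces \<open>v = 0\<close>.
\<close>

lemma nonneg_subinvariant_vec_zero:
  fixes G :: "real mat"
  assumes G: "G \<in> carrier_mat n n" and Gnn: "\<And>i j. i < n \<Longrightarrow> j < n \<Longrightarrow> 0 \<le> G $$ (i, j)"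
    and rho: "real_spectral_radius G < 1"
    and v: "v \<in> carrier_vec n"
    and sub: "\<And>i. i < n \<Longrightarrow> 0 \<le> v $ i \<and> v $ i \<le> (G *\<^sub>v v) $ i"
  shows "v = 0\<^sub>v n"
proof (cases "n = 0")
  \<comment> \<open>In dimension \<open>0\<close> the spectrum is empty and the spectral radius an unspecified maximum.\<close>
  case True
  then show ?thesis using v by auto
next
  case False
  then have n: "0 < n" by simp
  let ?h = "complex_of_real"
  let ?r = "real_spectral_radius G"
  have Gc: "map_mat ?h G \<in> carrier_mat n n" using G by simp
  have r0: "0 \<le> ?r"
    using spectral_radius_mem_max(1)[OF Gc n] by (auto simp: real_spectral_radius_def)
  \<comment> \<open>The harmonic mean of \<open>1\<close> and \<open>1 / ?r\<close>, in a form that also covers \<open>?r = 0\<close>.\<close>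
  define a where "a = 2 / (1 + ?r)"
  have a1: "1 < a" and ar: "a * ?r < 1" using rho r0 by (auto simp: a_def field_simps)
  define H where "H = a \<cdot>\<^sub>m G"
  have H: "H \<in> carrier_mat n n" using G by (simp add: H_def)
  have Hc: "map_mat ?h H \<in> carrier_mat n n" using H by simp
  have "spectral_radius (map_mat ?h H) < 1"
  proof -
    obtain l where l: "l \<in> spectrum (map_mat ?h H)" "spectral_radius (map_mat ?h H) = norm l"
      using spectral_radius_mem_max(1)[OF Hc n] by auto
    obtain w where w: "w \<in> carrier_vec n" "w \<noteq> 0\<^sub>v n" "map_mat ?h H *\<^sub>v w = l \<cdot>\<^sub>v w"
      using l(1) H by (auto simp: spectrum_def eigenvalue_def eigenvector_def)
    have HG: "map_mat ?h H = ?h a \<cdot>\<^sub>m map_mat ?h G" by (auto simp: H_def)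
    have "?h a \<cdot>\<^sub>v (map_mat ?h G *\<^sub>v w) = l \<cdot>\<^sub>v w"
      using w(3) unfolding HG by (simp add: smult_mat_mult_vec[OF Gc w(1)])
    then have "(1 / ?h a) \<cdot>\<^sub>v (?h a \<cdot>\<^sub>v (map_mat ?h G *\<^sub>v w)) = (1 / ?h a) \<cdot>\<^sub>v (l \<cdot>\<^sub>v w)"
      by simp
    then have "map_mat ?h G *\<^sub>v w = (l / ?h a) \<cdot>\<^sub>v w"
      using a1 by (simp add: smult_smult_assoc)
    then have "l / ?h a \<in> spectrum (map_mat ?h G)"
      using w G unfolding spectrum_def eigenvalue_def eigenvector_def by auto
    then have "norm (l / ?h a) \<le> ?r"
      unfolding real_spectral_radius_def by (intro spectral_radius_mem_max(2)[OF Gc n]) auto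
    then have "norm l \<le> a * ?r" using a1 by (simp add: norm_divide field_simps)
    then show ?thesis using l(2) ar by simp
  qed
  then obtain c where c: "\<And>k. norm_bound (map_mat ?h H ^\<^sub>m k) c"
    using spectral_radius_jnf_norm_bound_less_1_upper_triangular[OF Hc] by blast
  have Hbound: "\<bar>(H ^\<^sub>m k) $$ (i, j)\<bar> \<le> c" if "i < n" "j < n" for k i j
  proof -
    have "norm_bound (map_mat ?h (H ^\<^sub>m k)) c"
      using c[of k] unfolding of_real_hom.mat_hom_pow[OF H] .
    moreover have "dim_row (H ^\<^sub>m k) = n" "dim_col (H ^\<^sub>m k) = n" using H by auto
    ultimately have "norm (map_mat ?h (H ^\<^sub>m k) $$ (i, j)) \<le> c"
      using that by (simp only: norm_bound_def index_map_mat(2,3))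
    then show ?thesis
      using that \<open>dim_row (H ^\<^sub>m k) = n\<close> \<open>dim_col (H ^\<^sub>m k) = n\<close>
      by (simp only: index_map_mat(1) norm_of_real real_norm_def)
  qed
  have Hnn: "0 \<le> (H ^\<^sub>m k) $$ (i, j)" if "i < n" "j < n" for k i j
    using that
  proof (induction k arbitrary: i j)
    case 0
    then show ?case using H by simp
  next
    case (Suc k)
    have "(H ^\<^sub>m Suc k) $$ (i, j) = (\<Sum>l<n. (H ^\<^sub>m k) $$ (i, l) * H $$ (l, j))"
      using Suc.prems H pow_carrier_mat[OF H, of k] by (simp add: scalar_prod_def lessThan_atLeast0)
    moreover have "0 \<le> H $$ (l, j)" if "l < n" for l
      using that Suc.prems Gnn G a1 by (simp add: H_def)
    ultimately show ?case using Suc by (auto intro!: sum_nonneg)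
  qed
  have iter: "a ^ k * v $ i \<le> (\<Sum>j<n. (H ^\<^sub>m k) $$ (i, j) * v $ j)" if "i < n" for k i
    using that
  proof (induction k arbitrary: i)
    case 0
    then have "(\<Sum>j<n. (H ^\<^sub>m 0) $$ (i, j) * v $ j) = (\<Sum>j<n. if i = j then v $ j else 0)"
      using H by (intro sum.cong) auto
    then show ?case using 0 by simp
  next
    case (Suc k)
    have Hk: "H ^\<^sub>m k \<in> carrier_mat n n" using H by simp
    have "a ^ Suc k * v $ i \<le> a * (\<Sum>j<n. (H ^\<^sub>m k) $$ (i, j) * v $ j)"
      using Suc.IH[OF Suc.prems] a1 by (simp add: mult.assoc)
    also have "\<dots> = (\<Sum>j<n. (H ^\<^sub>m k) $$ (i, j) * (a * v $ j))"
      by (simp add: sum_distrib_left mult_ac)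
    also have "\<dots> \<le> (\<Sum>j<n. (H ^\<^sub>m k) $$ (i, j) * (H *\<^sub>v v) $ j)"
    proof (intro sum_mono mult_left_mono)
      fix j assume "j \<in> {..<n}"
      then have j: "j < n" by simp
      have "(H *\<^sub>v v) $ j = a * (G *\<^sub>v v) $ j"
        using j G v by (simp add: H_def smult_mat_mult_vec del: index_mult_mat_vec)
      then show "a * v $ j \<le> (H *\<^sub>v v) $ j" using sub[OF j] a1 by simp
      show "0 \<le> (H ^\<^sub>m k) $$ (i, j)" using Hnn Suc.prems j by simp
    qed
    also have "\<dots> = ((H ^\<^sub>m k) *\<^sub>v (H *\<^sub>v v)) $ i"
      using Suc.prems Hk H v by (simp add: scalar_prod_def lessThan_atLeast0)
    also have "(H ^\<^sub>m k) *\<^sub>v (H *\<^sub>v v) = (H ^\<^sub>m Suc k) *\<^sub>v v"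
      using assoc_mult_mat_vec[OF Hk H v] by simp
    also have "\<dots> $ i = (\<Sum>j<n. (H ^\<^sub>m Suc k) $$ (i, j) * v $ j)"
      using Suc.prems Hk H v by (simp add: scalar_prod_def lessThan_atLeast0)
    finally show ?case .
  qed
  define d where "d = (\<Sum>j<n. c * v $ j)"
  have bound: "a ^ k * v $ i \<le> d" if "i < n" for k i
  proof -
    have "(\<Sum>j<n. (H ^\<^sub>m k) $$ (i, j) * v $ j) \<le> d"
      unfolding d_def
      by (intro sum_mono mult_right_mono) (use that Hbound sub in \<open>auto intro: order_trans[OF abs_ge_self]\<close>)
    then show ?thesis using iter[OF that, of k] by simp
  qed
  have "v $ i = 0" if i: "i < n" for i
  proof (rule ccontr)
    assume "v $ i \<noteq> 0"
    then have vi: "0 < v $ i" using sub[OF i] by simp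
    obtain k where "d / v $ i < a ^ k" using real_arch_pow[OF a1] by blast
    then show False using bound[OF i, of k] vi by (simp add: field_simps)
  qed
  then show ?thesis using v by auto
qed


section \<open>Perturbation of the midpoint matrix\<close>

lemma param_mat_carrier [simp]: "param_mat n K A p \<in> carrier_mat n n"
  by (simp add: param_mat_def)

lemma rad_mat_carrier [simp]: "rad_mat n K A lo up \<in> carrier_mat n n"
  by (simp add: rad_mat_def)

lemma box_mid_in_param_box:
  assumes "\<And>k. k \<in> {1..K} \<Longrightarrow> lo k \<le> up k"
  shows "box_mid K lo up \<in> param_box K lo up"
  using assms by (force simp: box_mid_def param_box_def)

lemma param_mat_deviation_le_rad_mat:
  assumes A: "\<And>k. k \<le> K \<Longrightarrow> A k \<in> carrier_mat n n"
    and p: "p \<in> param_box K lo up" and ij: "i < n" "j < n"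
  shows "\<bar>param_mat n K A p $$ (i, j) - param_mat n K A (box_mid K lo up) $$ (i, j)\<bar>
    \<le> rad_mat n K A lo up $$ (i, j)"
proof -
  have "param_mat n K A p $$ (i, j) - param_mat n K A (box_mid K lo up) $$ (i, j)
    = (\<Sum>k = 1..K. A k $$ (i, j) * (p k - box_mid K lo up k))"
    using ij by (simp add: param_mat_def sum_subtractf algebra_simps)
  also have "\<bar>\<dots>\<bar> \<le> (\<Sum>k = 1..K. \<bar>A k $$ (i, j) * (p k - box_mid K lo up k)\<bar>)"
    by (rule sum_abs)
  also have "\<dots> \<le> (\<Sum>k = 1..K. abs_mat (A k) $$ (i, j) * box_rad K lo up k)"
  proof (rule sum_mono)
    fix k assume k: "k \<in> {1..K}"
    then have "p k \<in> {lo k..up k}" using p by (auto simp: param_box_def)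
    then have "\<bar>p k - box_mid K lo up k\<bar> \<le> box_rad K lo up k"
      using k by (auto simp: box_mid_def box_rad_def abs_le_iff field_simps)
    moreover have "abs_mat (A k) $$ (i, j) = \<bar>A k $$ (i, j)\<bar>"
      using A[of k] k ij by (auto simp: abs_mat_def)
    ultimately show "\<bar>A k $$ (i, j) * (p k - box_mid K lo up k)\<bar>
        \<le> abs_mat (A k) $$ (i, j) * box_rad K lo up k"
      by (simp add: abs_mult mult_left_mono)
  qed
  also have "\<dots> = rad_mat n K A lo up $$ (i, j)" using ij by (simp add: rad_mat_def)
  finally show ?thesis .
qed

text \<open>
  This discharges the option type behind \<^const>\<open>mat_inv\<close>: a trivial kernel makes the determinant
  nonzero, so Gauss--Jordan elimination finds an inverse.
\<close>

lemma mat_inv_left_inverse: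
  assumes M: "M \<in> carrier_mat n n"
    and ker: "\<And>x. x \<in> carrier_vec n \<Longrightarrow> M *\<^sub>v x = 0\<^sub>v n \<Longrightarrow> x = 0\<^sub>v n"
  shows "mat_inv M \<in> carrier_mat n n" "mat_inv M * M = 1\<^sub>m n"
proof -
  have "det M \<noteq> 0" using det_0_iff_vec_prod_zero_field[OF M] ker by blast
  then have "M \<in> Units (ring_mat TYPE(real) n ())" by (rule det_non_zero_imp_unit[OF M])
  then obtain N where N: "mat_inverse M = Some N" using mat_inverse(1)[OF M, of "()"] by (meson option.exhaust)
  then show "mat_inv M \<in> carrier_mat n n" "mat_inv M * M = 1\<^sub>m n"
    using mat_inverse(2)[OF M N] by (auto simp: mat_inv_def)
qed

text \<open>
  A kernel vector satisfies \<open>M x = - t (S - M) x\<close>, hence \<open>\<bar>M x\<bar> \<le> B \<bar>x\<bar>\<close>. Applying the left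
  inverse \<open>N\<close> of \<open>M\<close> gives \<open>\<bar>x\<bar> \<le> \<bar>N\<bar> B \<bar>x\<bar>\<close>, a subinvariant vector of a matrix with spectral
  radius below \<open>1\<close>.
\<close>

lemma segment_nonsingular:
  assumes M: "M \<in> carrier_mat n n" and S: "S \<in> carrier_mat n n" and B: "B \<in> carrier_mat n n"
    and N: "N \<in> carrier_mat n n" and NM: "N * M = 1\<^sub>m n"
    and dev: "\<And>i j. i < n \<Longrightarrow> j < n \<Longrightarrow> \<bar>S $$ (i, j) - M $$ (i, j)\<bar> \<le> B $$ (i, j)"
    and rho: "real_spectral_radius (abs_mat N * B) < 1"
    and t: "0 \<le> t" "t \<le> 1"
    and x: "x \<in> carrier_vec n" and zero: "segment M S t *\<^sub>v x = 0\<^sub>v n"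
  shows "x = 0\<^sub>v n"
proof -
  define v where "v = map_vec abs x"
  have v: "v \<in> carrier_vec n" using x by (simp add: v_def)
  have aN: "abs_mat N \<in> carrier_mat n n" using N by (simp add: abs_mat_def)
  have Bnn: "0 \<le> B $$ (i, j)" if "i < n" "j < n" for i j
    using dev[OF that] by linarith
  have Mx: "\<bar>(M *\<^sub>v x) $ l\<bar> \<le> (B *\<^sub>v v) $ l" if l: "l < n" for l
  proof -
    have "0 = (segment M S t *\<^sub>v x) $ l" using zero l by simp
    also have "\<dots> = (1 - t) * (\<Sum>j<n. M $$ (l, j) * x $ j) + t * (\<Sum>j<n. S $$ (l, j) * x $ j)"
      using l M S x segment_mult_vec[OF M S x]
      by (simp add: scalar_prod_def lessThan_atLeast0)
    also have "\<dots> = (\<Sum>j<n. M $$ (l, j) * x $ j)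
        + t * (\<Sum>j<n. (S $$ (l, j) - M $$ (l, j)) * x $ j)"
      by (simp add: left_diff_distrib sum_subtractf algebra_simps)
    finally have "(\<Sum>j<n. M $$ (l, j) * x $ j)
        = - (t * (\<Sum>j<n. (S $$ (l, j) - M $$ (l, j)) * x $ j))" by linarith
    then have "\<bar>\<Sum>j<n. M $$ (l, j) * x $ j\<bar>
        = t * \<bar>\<Sum>j<n. (S $$ (l, j) - M $$ (l, j)) * x $ j\<bar>"
      using t by (simp only: abs_minus_cancel abs_mult abs_of_nonneg)
    also have "\<dots> \<le> \<bar>\<Sum>j<n. (S $$ (l, j) - M $$ (l, j)) * x $ j\<bar>"
      using t by (simp add: mult_left_le_one_le)
    also have "\<dots> \<le> (\<Sum>j<n. \<bar>(S $$ (l, j) - M $$ (l, j)) * x $ j\<bar>)" by (rule sum_abs)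
    also have "\<dots> \<le> (\<Sum>j<n. B $$ (l, j) * \<bar>x $ j\<bar>)"
      using dev l by (intro sum_mono) (simp add: abs_mult mult_right_mono)
    finally show ?thesis
      using l M B x by (simp add: v_def scalar_prod_def lessThan_atLeast0)
  qed
  have "v = 0\<^sub>v n"
  proof (rule nonneg_subinvariant_vec_zero[OF _ _ rho v])
    show "abs_mat N * B \<in> carrier_mat n n" using aN B by simp
    show "0 \<le> (abs_mat N * B) $$ (i, j)" if "i < n" "j < n" for i j
      using that N B Bnn by (auto simp: abs_mat_def scalar_prod_def intro!: sum_nonneg)
    show "0 \<le> v $ i \<and> v $ i \<le> ((abs_mat N * B) *\<^sub>v v) $ i" if i: "i < n" for i
    proof
      show "0 \<le> v $ i" using i x by (simp add: v_def)
      have "x = N *\<^sub>v (M *\<^sub>v x)" using assoc_mult_mat_vec[OF N M x] NM x by simp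
      then have "x $ i = (\<Sum>l<n. N $$ (i, l) * (M *\<^sub>v x) $ l)"
        using i N M by (metis (no_types, lifting) atLeast0LessThan carrier_matD
            dim_mult_mat_vec index_mult_mat_vec index_row(1) lessThan_iff scalar_prod_def sum.cong)
      then have "v $ i \<le> (\<Sum>l<n. \<bar>N $$ (i, l) * (M *\<^sub>v x) $ l\<bar>)"
        using i x sum_abs by (simp add: v_def)
      also have "\<dots> \<le> (\<Sum>l<n. abs_mat N $$ (i, l) * (B *\<^sub>v v) $ l)"
        using Mx i N
        by (intro sum_mono) (simp add: abs_mat_def abs_mult mult_left_mono del: index_mult_mat_vec)
      also have "\<dots> = (abs_mat N *\<^sub>v (B *\<^sub>v v)) $ i"
        using i aN B by (simp add: scalar_prod_def lessThan_atLeast0)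
      also have "abs_mat N *\<^sub>v (B *\<^sub>v v) = (abs_mat N * B) *\<^sub>v v"
        using assoc_mult_mat_vec[OF aN B v] by simp
      finally show "v $ i \<le> ((abs_mat N * B) *\<^sub>v v) $ i" .
    qed
  qed
  have "x $ i = 0" if i: "i < n" for i
  proof -
    have "v $ i = 0" using \<open>v = 0\<^sub>v n\<close> i by simp
    then show ?thesis using i x by (simp add: v_def)
  qed
  then show ?thesis using x by auto
qed

theorem theorem4p4:
  fixes n K :: nat
    and A :: "nat \<Rightarrow> real mat"
    and lo up :: "nat \<Rightarrow> real"
  assumes "\<And>k. k \<le> K \<Longrightarrow> A k \<in> carrier_mat n n"
    and "\<And>k. k \<in> {1..K} \<Longrightarrow> lo k \<le> up k"
    and "symmetric_param n K A lo up"
    and "stable_mat (param_mat n K A (box_mid K lo up))"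
    and "real_spectral_radius
           (abs_mat (mat_inv (param_mat n K A (box_mid K lo up))) * rad_mat n K A lo up) < 1"
  shows "stable_param n K A lo up"
  unfolding stable_param_def
proof
  fix p assume p: "p \<in> param_box K lo up"
  let ?M = "param_mat n K A (box_mid K lo up)" and ?S = "param_mat n K A p"
  have symM: "transpose_mat ?M = ?M" and symS: "transpose_mat ?S = ?S"
    using assms(3) p box_mid_in_param_box[OF assms(2)] by (auto simp: symmetric_param_def)
  have M: "neg_definite n ?M"
    by (rule stable_symmetric_imp_neg_definite[OF param_mat_carrier symM assms(4)])
  have ker: "x = 0\<^sub>v n" if x: "x \<in> carrier_vec n" "?M *\<^sub>v x = 0\<^sub>v n" for x
  proof (rule ccontr)
    assume "x \<noteq> 0\<^sub>v n"
    then have "x \<bullet> (?M *\<^sub>v x) < 0" using M x(1) unfolding neg_definite_def by blast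
    then show False using x by simp
  qed
  have N: "mat_inv ?M \<in> carrier_mat n n" by (rule mat_inv_left_inverse(1)[OF param_mat_carrier ker])
  have NM: "mat_inv ?M * ?M = 1\<^sub>m n" by (rule mat_inv_left_inverse(2)[OF param_mat_carrier ker])
  have "neg_definite n ?S"
  proof (rule neg_definite_along_segment[OF param_mat_carrier param_mat_carrier symM symS M])
    fix t :: real and x
    assume t: "0 < t" "t \<le> 1" and x: "x \<in> carrier_vec n" "segment ?M ?S t *\<^sub>v x = 0\<^sub>v n"
    show "x = 0\<^sub>v n"
      by (rule segment_nonsingular[OF param_mat_carrier param_mat_carrier rad_mat_carrier N NM
            param_mat_deviation_le_rad_mat[OF assms(1) p] assms(5) less_imp_le[OF t(1)] t(2) x])
  qed
  then show "stable_mat ?S" by (rule neg_definite_imp_stable[OF param_mat_carrier])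
qed

end
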